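(* Let $K=2$, $0<v_1<v_2$, $\eta=v_1/v_2$, and let $\alpha^*\in[0,1]$ be the probability of the high value $v_2$ in the aggregated market. The maximum producer utility across all segmentations, $\beta\mapsto\max\{u_p:(u_c,u_p)\in\mathcal S_\beta\}$, is a decreasing function of $\beta$ over the interval $[0,\min\{2\eta,2(1-\eta)\}]$ if and only if either $\alpha^*\ge1/2$ and $\eta\ge1/2$, or $\alpha^*\le1/2$ and $\eta\le1/2$.
   Context: Values are $\mathcal V=\{v_1,v_2\}$. A market is a probability distribution $x$ on $\mathcal V$, identified with $\alpha=x(v_2)\in[0,1]$; $\mathcal X$ is the set of all markets and $\mathrm{Unif}(\mathcal X)$ the uniform distribution on it (i.e. $\alpha$ uniform on $[0,1]$). The aggregated market is $x^*=(1-\alpha^*,\alpha^* )$. A segmentation is a finitely supported probability distribution $\sigma$ on $\mathcal X$ with $\sum_x\sigma(x)x=x^*$; $\Sigma$ is the set of segmentations. For a price $p\ge0$ and market $x$: $\mathcal U_p(p,x)=p\sum_k x(v_k)\mathbf 1(p\le v_k)$ (producer) and $\mathcal U_c(p,x)=\sum_k x(v_k)(v_k-p)\mathbf 1(p\le v_k)$ (consumer). Privacy mechanism with parameter $\beta\in[0,1]$: $\mathcal M_\beta(x)$ equals $x$ with probability $1-\beta$ and, with probability $\beta$, is a draw from $\mathrm{Unif}(\mathcal X)$. The producer has prior $\mathrm{Unif}(\mathcal X)$; after observing $\hat x$ the posterior is $\pi_\beta(\cdot|\hat x)=(1-\beta)\delta_{\hat x}+\beta\,\mathrm{Unif}(\mathcal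 X)$. Put $\mathcal U_p(p|\hat x)=\mathbb E_{x\sim\pi_\beta(\cdot|\hat x)}[\mathcal U_p(p,x)]$. A price $p$ is optimal given $\hat x$ if $\mathcal U_p(p|\hat x)\ge\mathcal U_p(p'|\hat x)$ for all $p'\ge0$ (optimal prices lie in $\mathcal V$). An optimal pricing rule is a map $\phi:\mathcal X\to\Delta(\mathcal V)$ such that for each $\hat x$ the support of $\phi(\hat x)$ consists only of prices optimal given $\hat x$. For $\bullet\in\{p,c\}$ let $U_\bullet^\phi(x)=\mathbb E_{\hat x\sim\mathcal M_\beta(x)}\mathbb E_{q\sim\phi(\hat x)}[\mathcal U_\bullet(q,x)]$. Then $\mathcal S_\beta$ is the set of (consumer, producer) utility pairs $\big(\sum_x\sigma(x)U_c^\phi(x),\ \sum_x\sigma(x)U_p^\phi(x)\big)$ over all $\sigma\in\Sigma$ and all optimal pricing rules $\phi$ (for parameter $\beta$).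
   Formalization: Monotonicity is stated on the interval without the point β=1, which lies in it only when η=1/2; there the English fails for α*≠1/2, since at β=1 both prices are optimal for every observation and the maximum jumps up (v1=1, v2=2, α*=1: 7/4 at β=1/2, 2 at β=1). *)

theory Defs
  imports "HOL-Probability.Probability"
begin

text \<open>
  There are two values \<open>0 < v1 < v2\<close>.  A market is identified with the probability
  \<open>\<alpha>\<close> in \<open>[0,1]\<close> that it gives to the value \<open>v2\<close>.
\<close>

definition market_space :: "real measure" where
  "market_space = restrict_space borel {0..1}"

definition uniform_market :: "real measure" where
  "uniform_market = uniform_measure (restrict_space lborel {0..1}) {0..1}"

definition market_prob :: "real \<Rightarrow> nat \<Rightarrow> real" where
  "market_prob \<alpha> k = (if k = 1 then 1 - \<alpha> else \<alpha>)"

definition market_value :: "real \<Rightarrow> real \<Rightarrow> nat \<Rightarrow> real" where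
  "market_value v1 v2 k = (if k = 1 then v1 else v2)"

definition producer_utility :: "real \<Rightarrow> real \<Rightarrow> real \<Rightarrow> real \<Rightarrow> real" where
  "producer_utility v1 v2 p \<alpha> =
     p * (\<Sum>k\<in>{1,2}. market_prob \<alpha> k * of_bool (p \<le> market_value v1 v2 k))"

definition consumer_utility :: "real \<Rightarrow> real \<Rightarrow> real \<Rightarrow> real \<Rightarrow> real" where
  "consumer_utility v1 v2 p \<alpha> =
     (\<Sum>k\<in>{1,2}. market_prob \<alpha> k * (market_value v1 v2 k - p) * of_bool (p \<le> market_value v1 v2 k))"

text \<open>
  \<open>noisy_market \<beta> x\<close> is \<open>(1 - \<beta>) \<delta>\<^sub>x + \<beta> Unif\<close>, for \<open>\<beta>\<close> in \<open>[0,1]\<close>.  It is the law of the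
  output of the privacy mechanism on input \<open>x\<close>; as the prior is uniform, it is also the
  producer's posterior when the output \<open>x\<close> is observed.
\<close>

definition noisy_market :: "real \<Rightarrow> real \<Rightarrow> real measure" where
  "noisy_market \<beta> x =
     measure_pmf (bernoulli_pmf \<beta>) \<bind> (\<lambda>b. if b then uniform_market else return market_space x)"

abbreviation privacy_mechanism :: "real \<Rightarrow> real \<Rightarrow> real measure" where
  "privacy_mechanism \<equiv> noisy_market"

abbreviation posterior :: "real \<Rightarrow> real \<Rightarrow> real measure" where
  "posterior \<equiv> noisy_market"

definition posterior_producer_utility :: "real \<Rightarrow> real \<Rightarrow> real \<Rightarrow> real \<Rightarrow> real \<Rightarrow> real" where
  "posterior_producer_utility v1 v2 \<beta> p xhat = (\<integral>x. producer_utility v1 v2 p x \<partial>posterior \<beta> xhat)"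

definition optimal_price :: "real \<Rightarrow> real \<Rightarrow> real \<Rightarrow> real \<Rightarrow> real \<Rightarrow> bool" where
  "optimal_price v1 v2 \<beta> xhat p \<longleftrightarrow>
     0 \<le> p \<and> (\<forall>p'\<ge>0. posterior_producer_utility v1 v2 \<beta> p' xhat \<le> posterior_producer_utility v1 v2 \<beta> p xhat)"

text \<open>
  A pricing rule only matters on markets, that is on \<open>[0,1]\<close>.  Measurability is required because
  utilities are expectations over the observed market; without it the Bochner integral
  would be the default value 0.
\<close>

definition optimal_pricing_rule :: "real \<Rightarrow> real \<Rightarrow> real \<Rightarrow> (real \<Rightarrow> real pmf) \<Rightarrow> bool" where
  "optimal_pricing_rule v1 v2 \<beta> \<phi> \<longleftrightarrow>
     (\<forall>xhat\<in>{0..1}. set_pmf (\<phi> xhat) \<subseteq> {v1, v2}) \<and>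
     (\<forall>v\<in>{v1, v2}. (\<lambda>xhat. pmf (\<phi> xhat) v) \<in> borel_measurable market_space) \<and>
     (\<forall>xhat\<in>{0..1}. \<forall>p\<in>set_pmf (\<phi> xhat). optimal_price v1 v2 \<beta> xhat p)"

definition expected_utility ::
    "(real \<Rightarrow> real \<Rightarrow> real) \<Rightarrow> real \<Rightarrow> (real \<Rightarrow> real pmf) \<Rightarrow> real \<Rightarrow> real" where
  "expected_utility U \<beta> \<phi> x =
     (\<integral>xhat. measure_pmf.expectation (\<phi> xhat) (\<lambda>q. U q x) \<partial>privacy_mechanism \<beta> x)"

definition segmentation :: "real \<Rightarrow> real pmf \<Rightarrow> bool" where
  "segmentation \<alpha>star \<sigma> \<longleftrightarrow>
     finite (set_pmf \<sigma>) \<and> set_pmf \<sigma> \<subseteq> {0..1} \<and> (\<Sum>x\<in>set_pmf \<sigma>. pmf \<sigma> x * x) = \<alpha>star"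

text \<open>The set of achievable pairs (consumer utility, producer utility).\<close>

definition utility_pairs :: "real \<Rightarrow> real \<Rightarrow> real \<Rightarrow> real \<Rightarrow> (real \<times> real) set" where
  "utility_pairs v1 v2 \<alpha>star \<beta> =
     {(\<Sum>x\<in>set_pmf \<sigma>. pmf \<sigma> x * expected_utility (consumer_utility v1 v2) \<beta> \<phi> x,
       \<Sum>x\<in>set_pmf \<sigma>. pmf \<sigma> x * expected_utility (producer_utility v1 v2) \<beta> \<phi> x) | \<sigma> \<phi>.
       segmentation \<alpha>star \<sigma> \<and> optimal_pricing_rule v1 v2 \<beta> \<phi>}"

definition is_max_producer_utility :: "real \<Rightarrow> real \<Rightarrow> real \<Rightarrow> real \<Rightarrow> real \<Rightarrow> bool" where
  "is_max_producer_utility v1 v2 \<alpha>star \<beta> u \<longleftrightarrow>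
     (\<exists>uc. (uc, u) \<in> utility_pairs v1 v2 \<alpha>star \<beta>) \<and>
     (\<forall>(uc, up)\<in>utility_pairs v1 v2 \<alpha>star \<beta>. up \<le> u)"

definition max_producer_utility :: "real \<Rightarrow> real \<Rightarrow> real \<Rightarrow> real \<Rightarrow> real" where
  "max_producer_utility v1 v2 \<alpha>star \<beta> = (THE u. is_max_producer_utility v1 v2 \<alpha>star \<beta> u)"

text \<open>
  This function need not be decreasing up to \<open>\<beta> = 1\<close> when \<open>v1 / v2 = 1/2\<close>: at \<open>\<beta> = 1\<close> both prices are
  then optimal for every observation, and the maximum jumps up unless \<open>\<alpha>star = 1/2\<close>.
  For example, for \<open>v1 = 1\<close>, \<open>v2 = 2\<close>, \<open>\<alpha>star = 1\<close> it is \<open>2 - \<beta>/2\<close> if \<open>\<beta> < 1\<close> but \<open>2\<close> if \<open>\<beta> = 1\<close>.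
  Monotonicity on \<open>[0, min {2\<eta>, 2(1-\<eta>)}]\<close> is therefore considered without the point \<open>1\<close>,
  which belongs to that interval only if \<open>\<eta> = 1/2\<close>.
\<close>

end

theory Submission
  imports Defs
begin

text \<open>
  Write \<open>\<eta> = v1 / v2\<close>.  After observing \<open>x\<close> the producer faces a market of mean \<open>(1 - \<beta>) x + \<beta> / 2\<close>, so
  she posts \<open>v1\<close> below and \<open>v2\<close> above the threshold \<open>t = (\<eta> - \<beta> / 2) / (1 - \<beta>)\<close>, which lies in
  \<open>[0,1]\<close> precisely in the range of \<open>\<beta>\<close> under consideration.  The noise part of the mechanism
  contributes an affine function of the market and is the same for every segmentation; the
  remaining part is maximized by full disclosure.  This gives an explicit maximum, which in terms
  of \<open>s = 1 - \<beta>\<close> reads \<open>v2 (C + A s + B / s)\<close>.  Its increments have the sign of \<open>A s s' - B\<close>, an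
  affine expression in \<open>s s'\<close> that is positive at \<open>1\<close> and has the sign of
  \<open>(2\<eta> - 1) (2\<alpha>star - 1)\<close> at \<open>(2\<eta> - 1)\<^sup>2\<close>, the smallest possible value of \<open>s s'\<close>.
\<close>

section \<open>The privacy mechanism\<close>

lemma space_market_space [simp]: "space market_space = {0..1}"
  by (simp add: market_space_def space_restrict_space)

text \<open>The interval has Lebesgue measure 1, so the normalization does nothing and integrals
  become Lebesgue integrals over it.\<close>

lemma uniform_market_eq: "uniform_market = restrict_space lborel {0..1}"
proof (rule measure_eqI)
  fix A assume "A \<in> sets uniform_market"
  then have A: "A \<in> sets (restrict_space lborel {0..1::real})"
    by (simp add: uniform_market_def)
  then have "A \<subseteq> {0..1}"
    by (auto simp: sets_restrict_space)
  then have "{0..1} \<inter> A = A" by auto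
  moreover have "{0..1} \<in> sets (restrict_space lborel {0..1::real})"
    by (simp add: sets_restrict_space_iff)
  ultimately show "emeasure uniform_market A = emeasure (restrict_space lborel {0..1}) A"
    using A by (simp add: uniform_market_def emeasure_restrict_space divide_ennreal_def)
qed (simp add: uniform_market_def)

lemma sets_uniform_market [measurable_cong]: "sets uniform_market = sets market_space"
  unfolding uniform_market_eq market_space_def by (rule sets_restrict_space_cong) simp

lemma space_uniform_market [simp]: "space uniform_market = {0..1}"
  by (simp add: uniform_market_eq space_restrict_space)

lemma prob_space_uniform_market: "prob_space uniform_market"
  by (rule prob_spaceI) (simp add: uniform_market_eq emeasure_restrict_space space_restrict_space)

interpretation uniform_market: prob_space uniform_market
  by (rule prob_space_uniform_market)

lemma integral_uniform_market_id: "(\<integral>x. x \<partial>uniform_market) = 1/2"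
  using integral_power[of 0 1 1]
  by (simp add: uniform_market_eq integral_restrict_space mult.commute)

lemma measure_uniform_market_Icc:
  assumes "0 \<le> t" "t \<le> 1"
  shows "measure uniform_market {0..t} = t"
  using assms by (subst uniform_market_eq, subst measure_restrict_space) auto

lemma measure_uniform_market_space [simp]: "measure uniform_market {0..1} = 1"
  using uniform_market.prob_space by simp

lemma AE_uniform_market_neq: "AE x in uniform_market. x \<noteq> t"
  unfolding uniform_market_eq
  using AE_lborel_singleton[of t] by (subst AE_restrict_space_iff) auto

lemma kernel_measurable:
  assumes "x \<in> {0..1}"
  shows "(\<lambda>b. if b then uniform_market else return market_space x)
           \<in> measurable (measure_pmf M) (subprob_algebra market_space)"
proof -
  have "uniform_market \<in> space (subprob_algebra market_space)"
    by (simp add: space_subprob_algebra sets_uniform_market uniform_market.subprob_space_axioms)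
  moreover have "return market_space x \<in> space (subprob_algebra market_space)"
    using assms by (simp add: space_subprob_algebra subprob_space_return)
  ultimately show ?thesis by (auto simp: measurable_def)
qed

lemma space_noisy_market [simp]: "x \<in> {0..1} \<Longrightarrow> space (noisy_market \<beta> x) = {0..1}"
  unfolding noisy_market_def
  by (subst space_bind[where N = market_space]) (auto simp: sets_uniform_market)

text \<open>The bind is a mixture with weights \<open>1 - \<beta>\<close> and
  \<open>\<beta>\<close>. Measurability and the bound \<open>B\<close> allow the integral to be
  taken inside it.\<close>

lemma integral_noisy_market:
  fixes f :: "real \<Rightarrow> real"
  assumes "0 \<le> \<beta>" "\<beta> \<le> 1" and x: "x \<in> {0..1}"
    and f: "f \<in> borel_measurable market_space"
    and bound: "\<And>y. y \<in> {0..1} \<Longrightarrow> \<bar>f y\<bar> \<le> B"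
  shows "(\<integral>y. f y \<partial>noisy_market \<beta> x) = (1 - \<beta>) * f x + \<beta> * (\<integral>y. f y \<partial>uniform_market)"
proof -
  let ?N = "\<lambda>b. if b then uniform_market else return market_space x"
  have le: "emeasure (?N b) (space (?N b)) \<le> 1" for b
    using x uniform_market.emeasure_space_le_1
    by (cases b) (auto simp: emeasure_return market_space_def sets_restrict_space_iff space_restrict_space)
  have "(\<integral>y. f y \<partial>noisy_market \<beta> x) = (\<integral>b. integral\<^sup>L (?N b) f \<partial>bernoulli_pmf \<beta>)"
    unfolding noisy_market_def
    by (rule integral_bind[OF f _ kernel_measurable[OF x] measure_pmf.finite_measure_axioms, where B = B and B' = 1])
       (use bound le in auto)
  then show ?thesis
    using assms by (simp add: integral_return)
qed

section \<open>Prices and pricing rules\<close>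

lemma producer_utility_eq:
  assumes "v1 < v2"
  shows "producer_utility v1 v2 p x = (if p \<le> v1 then p else if p \<le> v2 then p * x else 0)"
  using assms by (auto simp: producer_utility_def market_prob_def market_value_def)

text \<open>At a fixed price the utility is affine in the market, so its posterior expectation is
  its value at the posterior mean.\<close>

lemma posterior_producer_utility_eq:
  assumes "v1 < v2" "0 \<le> \<beta>" "\<beta> \<le> 1" "x \<in> {0..1}"
  shows "posterior_producer_utility v1 v2 \<beta> p x = producer_utility v1 v2 p ((1 - \<beta>) * x + \<beta> / 2)"
proof -
  have m: "producer_utility v1 v2 p \<in> borel_measurable market_space"
    using assms(1) unfolding producer_utility_eq[OF assms(1), abs_def] market_space_def
    by (intro measurable_restrict_space1) measurable
  have b: "\<bar>producer_utility v1 v2 p y\<bar> \<le> \<bar>p\<bar>" if "y \<in> {0..1}" for y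
    using that by (auto simp: producer_utility_eq[OF assms(1)] abs_mult mult_left_le)
  have "(\<integral>y. producer_utility v1 v2 p y \<partial>uniform_market) = producer_utility v1 v2 p (1/2)"
    by (auto simp: producer_utility_eq[OF assms(1), abs_def] integral_uniform_market_id
     )
  moreover have "posterior_producer_utility v1 v2 \<beta> p x = (1 - \<beta>) * producer_utility v1 v2 p x +
      \<beta> * (\<integral>y. producer_utility v1 v2 p y \<partial>uniform_market)"
    unfolding posterior_producer_utility_def
    by (rule integral_noisy_market[OF assms(2-4) m b])
  ultimately show ?thesis
    by (auto simp: producer_utility_eq[OF assms(1)] algebra_simps)
qed

text \<open>Raising a price to the next of the two values loses no buyer; a price above
  \<open>v2\<close> sells nothing.\<close>

lemma producer_utility_le_max:
  assumes "0 < v1" "v1 < v2" "0 \<le> x"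
  shows "producer_utility v1 v2 p x \<le> max v1 (v2 * x)"
proof -
  have "p \<le> v2 \<Longrightarrow> p * x \<le> v2 * x"
    using assms(3) by (simp add: mult_right_mono)
  then show ?thesis
    using assms(1) unfolding producer_utility_eq[OF assms(2)] by (auto simp: max_def)
qed

text \<open>The bound \<open>max v1 (v2 * m)\<close> at the posterior mean \<open>m\<close> is
  attained by \<open>v1\<close> or \<open>v2\<close>, so optimality means attaining it.\<close>

lemma optimal_price_iff:
  assumes "0 < v1" "v1 < v2" "0 \<le> \<beta>" "\<beta> \<le> 1" "x \<in> {0..1}"
  shows "optimal_price v1 v2 \<beta> x p \<longleftrightarrow>
    0 \<le> p \<and> producer_utility v1 v2 p ((1 - \<beta>) * x + \<beta> / 2) = max v1 (v2 * ((1 - \<beta>) * x + \<beta> / 2))"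
proof -
  define m where "m = (1 - \<beta>) * x + \<beta> / 2"
  have m: "0 \<le> m" using assms by (auto simp: m_def)
  have "producer_utility v1 v2 v1 m = v1" "producer_utility v1 v2 v2 m = v2 * m"
    using assms(2) by (simp_all add: producer_utility_eq)
  then have "max v1 (v2 * m) \<le> producer_utility v1 v2 p m"
    if "\<forall>p'\<ge>0. producer_utility v1 v2 p' m \<le> producer_utility v1 v2 p m"
    using that[rule_format, of v1] that[rule_format, of v2] assms(1,2) by simp
  then have "(\<forall>p'\<ge>0. producer_utility v1 v2 p' m \<le> producer_utility v1 v2 p m) \<longleftrightarrow>
      producer_utility v1 v2 p m = max v1 (v2 * m)"
    using producer_utility_le_max[OF assms(1,2) m] by (auto intro: order.antisym)
  then show ?thesis
    by (simp add: optimal_price_def posterior_producer_utility_eq[OF assms(2-5)] m_def)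
qed

lemma optimal_price_low_high_iff:
  assumes "0 < v1" "v1 < v2" "0 \<le> \<beta>" "\<beta> \<le> 1" "x \<in> {0..1}"
  shows "optimal_price v1 v2 \<beta> x v1 \<longleftrightarrow> v2 * ((1 - \<beta>) * x + \<beta> / 2) \<le> v1"
    and "optimal_price v1 v2 \<beta> x v2 \<longleftrightarrow> v1 \<le> v2 * ((1 - \<beta>) * x + \<beta> / 2)"
  unfolding optimal_price_iff[OF assms] producer_utility_eq[OF assms(2)]
  using assms(1,2) by (auto simp: max_def)

lemma pmf_two_points:
  assumes "set_pmf p \<subseteq> {a, b}" "a \<noteq> b"
  shows "pmf p b = 1 - pmf p a"
    and "measure_pmf.expectation p f = pmf p a * f a + (1 - pmf p a) * (f b :: real)"
proof -
  have "(\<Sum>x\<in>{a, b}. pmf p x) = 1"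
    using assms by (intro sum_pmf_eq_1) auto
  then show *: "pmf p b = 1 - pmf p a"
    using assms(2) by simp
  have "measure_pmf.expectation p f = (\<Sum>x\<in>{a, b}. f x * pmf p x)"
    using assms(1) by (intro integral_measure_pmf_real) auto
  then show "measure_pmf.expectation p f = pmf p a * f a + (1 - pmf p a) * f b"
    using assms(2) * by (simp add: mult.commute)
qed

text \<open>The probability of posting \<open>v1\<close> given that the mechanism outputs noise; it
  does not depend on the true market.\<close>

definition low_price_prob :: "real \<Rightarrow> (real \<Rightarrow> real pmf) \<Rightarrow> real" where
  "low_price_prob v1 \<phi> = (\<integral>y. pmf (\<phi> y) v1 \<partial>uniform_market)"

text \<open>Here \<open>\<phi>\<close> is arbitrary: without integrability the Bochner integral is
  0, which also respects the bounds.\<close>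

lemma low_price_prob_bounds:
  "0 \<le> low_price_prob v1 \<phi>" "low_price_prob v1 \<phi> \<le> 1"
  unfolding low_price_prob_def
  by (simp, cases "integrable uniform_market (\<lambda>y. pmf (\<phi> y) v1)")
    (auto intro!: uniform_market.integral_le_const simp: pmf_le_1 not_integrable_integral_eq)

text \<open>The utility is affine in the weight put on \<open>v1\<close>, so the noise part sees
  \<open>\<phi>\<close> only through its average weight \<open>low_price_prob\<close>.\<close>

lemma expected_producer_utility_eq:
  assumes "0 < v1" "v1 < v2" "0 \<le> \<beta>" "\<beta> \<le> 1" "x \<in> {0..1}"
    and \<phi>: "optimal_pricing_rule v1 v2 \<beta> \<phi>"
  shows "expected_utility (producer_utility v1 v2) \<beta> \<phi> x =
    (1 - \<beta>) * (pmf (\<phi> x) v1 * v1 + (1 - pmf (\<phi> x) v1) * (v2 * x)) +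
    \<beta> * (low_price_prob v1 \<phi> * v1 + (1 - low_price_prob v1 \<phi>) * (v2 * x))"
proof -
  let ?g = "\<lambda>y. pmf (\<phi> y) v1 * (v1 - v2 * x) + v2 * x"
  have meas: "(\<lambda>y. pmf (\<phi> y) v1) \<in> borel_measurable market_space"
    using \<phi> by (simp add: optimal_pricing_rule_def)
  then have g: "?g \<in> borel_measurable market_space" by measurable
  have bound: "\<bar>?g y\<bar> \<le> \<bar>v1 - v2 * x\<bar> + \<bar>v2 * x\<bar>" for y
    by (rule order.trans[OF abs_triangle_ineq]) (simp add: abs_mult mult_right_le_one_le pmf_le_1 mult_left_le_one_le)
  have int: "integrable uniform_market (\<lambda>y. pmf (\<phi> y) v1)"
    using meas by (intro uniform_market.integrable_const_bound[where B = 1])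
      (auto simp: pmf_le_1 sets_uniform_market cong: measurable_cong_sets)
  have "expected_utility (producer_utility v1 v2) \<beta> \<phi> x = (\<integral>y. ?g y \<partial>noisy_market \<beta> x)"
    unfolding expected_utility_def
  proof (rule Bochner_Integration.integral_cong)
    fix y assume "y \<in> space (noisy_market \<beta> x)"
    then have "set_pmf (\<phi> y) \<subseteq> {v1, v2}"
      using \<phi> assms by (simp add: optimal_pricing_rule_def)
    then show "measure_pmf.expectation (\<phi> y) (\<lambda>q. producer_utility v1 v2 q x) = ?g y"
      using assms by (simp add: pmf_two_points(2) producer_utility_eq algebra_simps)
  qed simp
  also have "\<dots> = (1 - \<beta>) * ?g x + \<beta> * (\<integral>y. ?g y \<partial>uniform_market)"
    using assms by (intro integral_noisy_market[OF _ _ _ g bound]) auto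
  also have "(\<integral>y. ?g y \<partial>uniform_market) = low_price_prob v1 \<phi> * (v1 - v2 * x) + v2 * x"
    using int by (simp add: low_price_prob_def)
  finally show ?thesis by (simp add: algebra_simps)
qed

definition price_threshold :: "real \<Rightarrow> real \<Rightarrow> real" where
  "price_threshold \<eta> \<beta> = (\<eta> - \<beta> / 2) / (1 - \<beta>)"

lemma price_threshold_bounds:
  assumes "\<beta> < 1" "\<beta> \<le> 2 * \<eta>" "\<beta> \<le> 2 * (1 - \<eta>)"
  shows "0 \<le> price_threshold \<eta> \<beta>" "price_threshold \<eta> \<beta> \<le> 1"
  using assms by (auto simp: price_threshold_def field_simps)

lemma posterior_mean_le_iff:
  assumes "0 < v2" "\<beta> < 1"
  shows "v2 * ((1 - \<beta>) * x + \<beta> / 2) \<le> v1 \<longleftrightarrow> x \<le> price_threshold (v1 / v2) \<beta>"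
    and "v1 \<le> v2 * ((1 - \<beta>) * x + \<beta> / 2) \<longleftrightarrow> price_threshold (v1 / v2) \<beta> \<le> x"
  using assms by (simp_all add: price_threshold_def field_simps)

text \<open>Optimality fixes the price except at the threshold, which is a null set. Hence all
  optimal rules have the same noise part.\<close>

lemma low_price_prob_optimal:
  assumes "0 < v1" "v1 < v2" "0 \<le> \<beta>" "\<beta> < 1" "\<beta> \<le> 2 * (v1 / v2)" "\<beta> \<le> 2 * (1 - v1 / v2)"
    and \<phi>: "optimal_pricing_rule v1 v2 \<beta> \<phi>"
  shows "low_price_prob v1 \<phi> = price_threshold (v1 / v2) \<beta>"
proof -
  let ?t = "price_threshold (v1 / v2) \<beta>"
  have t: "0 \<le> ?t" "?t \<le> 1"
    using price_threshold_bounds assms by auto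
  have meas: "(\<lambda>y. pmf (\<phi> y) v1) \<in> borel_measurable uniform_market"
    using \<phi> by (simp add: optimal_pricing_rule_def sets_uniform_market cong: measurable_cong_sets)
  have set: "{0..?t} \<in> sets uniform_market"
    using t by (auto simp: sets_uniform_market market_space_def sets_restrict_space_iff)
  have "pmf (\<phi> y) v1 = indicator {0..?t} y" if y: "y \<in> {0..1}" "y \<noteq> ?t" for y
  proof -
    have sub: "set_pmf (\<phi> y) \<subseteq> {v1, v2}" and opt: "\<And>p. p \<in> set_pmf (\<phi> y) \<Longrightarrow> optimal_price v1 v2 \<beta> y p"
      using \<phi> y by (auto simp: optimal_pricing_rule_def)
    have "v1 \<in> set_pmf (\<phi> y) \<Longrightarrow> y \<le> ?t" "v2 \<in> set_pmf (\<phi> y) \<Longrightarrow> ?t \<le> y"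
      using opt[of v1] opt[of v2] assms y
      by (simp_all add: optimal_price_low_high_iff posterior_mean_le_iff)
    then have "y < ?t \<Longrightarrow> pmf (\<phi> y) v2 = 0" "?t < y \<Longrightarrow> pmf (\<phi> y) v1 = 0"
      by (auto simp: pmf_eq_0_set_pmf)
    then show ?thesis
      using pmf_two_points(1)[OF sub] assms y by (cases "y < ?t") auto
  qed
  then have "low_price_prob v1 \<phi> = (\<integral>y. indicator {0..?t} y \<partial>uniform_market)"
    unfolding low_price_prob_def using meas set AE_uniform_market_neq[of ?t]
    by (intro integral_cong_AE) auto
  then show ?thesis
    using set t by (simp add: measure_uniform_market_Icc)
qed

section \<open>The maximal producer utility\<close>

text \<open>An affine function sees only the barycentre, so its mean is the same under every
  segmentation.\<close>

lemma segmentation_sum_affine: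
  assumes "segmentation a \<sigma>"
  shows "(\<Sum>x\<in>set_pmf \<sigma>. pmf \<sigma> x * (c + d * x)) = c + d * a"
proof -
  have "(\<Sum>x\<in>set_pmf \<sigma>. pmf \<sigma> x) = 1" "(\<Sum>x\<in>set_pmf \<sigma>. pmf \<sigma> x * x) = a"
    using assms by (auto simp: segmentation_def intro: sum_pmf_eq_1)
  moreover have "(\<Sum>x\<in>set_pmf \<sigma>. pmf \<sigma> x * (c + d * x)) =
      c * (\<Sum>x\<in>set_pmf \<sigma>. pmf \<sigma> x) + d * (\<Sum>x\<in>set_pmf \<sigma>. pmf \<sigma> x * x)"
    by (simp add: sum.distrib sum_distrib_left algebra_simps)
  ultimately show ?thesis by simp
qed

lemma is_max_producer_utilityI:
  assumes "segmentation a \<sigma>" "optimal_pricing_rule v1 v2 \<beta> \<phi>"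
    and "(\<Sum>x\<in>set_pmf \<sigma>. pmf \<sigma> x * expected_utility (producer_utility v1 v2) \<beta> \<phi> x) = u"
    and "\<And>\<sigma> \<phi>. segmentation a \<sigma> \<Longrightarrow> optimal_pricing_rule v1 v2 \<beta> \<phi> \<Longrightarrow>
      (\<Sum>x\<in>set_pmf \<sigma>. pmf \<sigma> x * expected_utility (producer_utility v1 v2) \<beta> \<phi> x) \<le> u"
  shows "is_max_producer_utility v1 v2 a \<beta> u"
  unfolding is_max_producer_utility_def utility_pairs_def using assms by blast

lemma max_producer_utility_eqI:
  assumes "is_max_producer_utility v1 v2 a \<beta> u"
  shows "max_producer_utility v1 v2 a \<beta> = u"
  unfolding max_producer_utility_def
proof (rule the_equality)
  fix u' assume u': "is_max_producer_utility v1 v2 a \<beta> u'"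
  have "w \<le> w'" if "is_max_producer_utility v1 v2 a \<beta> w" "is_max_producer_utility v1 v2 a \<beta> w'" for w w'
    using that unfolding is_max_producer_utility_def by blast
  from this[OF u' assms] this[OF assms u'] show "u' = u"
    by (rule order.antisym)
qed (rule assms)

text \<open>For \<open>a\<close> in \<open>[0,1]\<close>, the split into the degenerate markets 0
  and 1. If \<open>a\<close> is 0 or 1, only one of them is in the support.\<close>

definition full_disclosure :: "real \<Rightarrow> real pmf" where
  "full_disclosure a = map_pmf of_bool (bernoulli_pmf a)"

lemma finite_set_full_disclosure: "finite (set_pmf (full_disclosure a))"
  by (simp add: full_disclosure_def)

lemma set_full_disclosure: "set_pmf (full_disclosure a) \<subseteq> {0, 1}"
  by (auto simp: full_disclosure_def)

lemma sum_full_disclosure: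
  fixes f :: "real \<Rightarrow> real"
  assumes "0 \<le> a" "a \<le> 1"
  shows "(\<Sum>x\<in>set_pmf (full_disclosure a). pmf (full_disclosure a) x * f x) = (1 - a) * f 0 + a * f 1"
proof -
  have "(\<Sum>x\<in>set_pmf (full_disclosure a). pmf (full_disclosure a) x * f x) =
      measure_pmf.expectation (full_disclosure a) f"
    by (subst integral_measure_pmf_real[OF finite_set_full_disclosure]) (auto simp: mult.commute)
  then show ?thesis
    using assms by (simp add: full_disclosure_def)
qed

lemma segmentation_full_disclosure:
  assumes "0 \<le> a" "a \<le> 1"
  shows "segmentation a (full_disclosure a)"
proof -
  have "set_pmf (full_disclosure a) \<subseteq> {0..1}"
    by (rule order.trans[OF set_full_disclosure]) simp
  then show ?thesis
    using sum_full_disclosure[OF assms, of "\<lambda>x. x"]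
    by (simp add: segmentation_def finite_set_full_disclosure)
qed

text \<open>Without noise the producer extracts the whole surplus; under noise she posts
  \<open>v1\<close> with probability equal to the threshold, and otherwise
  \<open>v2\<close>.\<close>

definition max_utility_formula :: "real \<Rightarrow> real \<Rightarrow> real \<Rightarrow> real \<Rightarrow> real" where
  "max_utility_formula v1 v2 a \<beta> = (1 - \<beta>) * ((1 - a) * v1 + a * v2) +
     \<beta> * (price_threshold (v1 / v2) \<beta> * v1 + (1 - price_threshold (v1 / v2) \<beta>) * (v2 * a))"

lemma optimal_pricing_rule_return:
  assumes "\<And>y. p y \<in> {v1, v2}" "p \<in> borel_measurable borel"
    and "\<And>y. y \<in> {0..1} \<Longrightarrow> optimal_price v1 v2 \<beta> y (p y)"
  shows "optimal_pricing_rule v1 v2 \<beta> (\<lambda>y. return_pmf (p y))"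
proof -
  have "(\<lambda>y. pmf (return_pmf (p y)) v) \<in> borel_measurable market_space" for v
    using assms(2) unfolding market_space_def pmf_return indicator_def
    by (intro measurable_restrict_space1) measurable
  then show ?thesis
    using assms by (auto simp: optimal_pricing_rule_def)
qed

text \<open>
  At a market \<open>x\<close> that is observed without noise the posted price earns \<open>v1\<close> or \<open>v2 * x\<close>, which are both at most
  \<open>v1 * (1 - x) + v2 * x\<close>.  This bound is affine in \<open>x\<close> and attained at \<open>0\<close> and \<open>1\<close>, so full
  disclosure is optimal.  Ties at \<open>0\<close> and \<open>1\<close> (thresholds \<open>0\<close> and \<open>1\<close>) are broken in favour of
  the producer.
\<close>

lemma is_max_producer_utility_formula:
  assumes v: "0 < v1" "v1 < v2" and \<beta>: "0 \<le> \<beta>" "\<beta> < 1" "\<beta> \<le> 2 * (v1 / v2)" "\<beta> \<le> 2 * (1 - v1 / v2)"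
    and a: "0 \<le> a" "a \<le> 1"
  shows "is_max_producer_utility v1 v2 a \<beta> (max_utility_formula v1 v2 a \<beta>)"
proof -
  let ?t = "price_threshold (v1 / v2) \<beta>"
  let ?p = "\<lambda>y. if y \<le> ?t \<and> y < 1 then v1 else v2"
  let ?\<phi> = "\<lambda>y. return_pmf (?p y)"
  have t: "0 \<le> ?t" "?t \<le> 1"
    using price_threshold_bounds \<beta> by auto
  have opt: "optimal_pricing_rule v1 v2 \<beta> ?\<phi>"
    using v \<beta> t by (intro optimal_pricing_rule_return)
      (auto simp: optimal_price_low_high_iff posterior_mean_le_iff)
  show ?thesis
  proof (rule is_max_producer_utilityI[OF segmentation_full_disclosure[OF a] opt])
    show "(\<Sum>x\<in>set_pmf (full_disclosure a). pmf (full_disclosure a) x *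
        expected_utility (producer_utility v1 v2) \<beta> ?\<phi> x) = max_utility_formula v1 v2 a \<beta>"
      using v \<beta> t opt
      by (simp add: sum_full_disclosure[OF a] expected_producer_utility_eq low_price_prob_optimal
          max_utility_formula_def) (simp add: algebra_simps)
  next
    fix \<sigma> \<phi> assume \<sigma>: "segmentation a \<sigma>" and \<phi>: "optimal_pricing_rule v1 v2 \<beta> \<phi>"
    \<comment> \<open>Intercept and slope of the affine majorant: the noise-free bound weighted by
      \<open>1 - \<beta>\<close>, plus the noise part.\<close>
    let ?c = "(1 - \<beta>) * v1 + \<beta> * ?t * v1" and ?d = "(1 - \<beta>) * (v2 - v1) + \<beta> * (1 - ?t) * v2"
    have "(\<Sum>x\<in>set_pmf \<sigma>. pmf \<sigma> x * expected_utility (producer_utility v1 v2) \<beta> \<phi> x)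
        \<le> (\<Sum>x\<in>set_pmf \<sigma>. pmf \<sigma> x * (?c + ?d * x))"
    proof (intro sum_mono mult_left_mono)
      fix x assume "x \<in> set_pmf \<sigma>"
      then have x: "0 \<le> x" "x \<le> 1" using \<sigma> by (auto simp: segmentation_def)
      have "v1 \<le> v1 * (1 - x) + v2 * x" "v2 * x \<le> v1 * (1 - x) + v2 * x"
        using x v by (simp_all add: algebra_simps mult_right_mono)
      then have "pmf (\<phi> x) v1 * v1 + (1 - pmf (\<phi> x) v1) * (v2 * x) \<le> v1 * (1 - x) + v2 * x"
        by (intro convex_bound_le) (auto simp: pmf_le_1)
      then have "(1 - \<beta>) * (pmf (\<phi> x) v1 * v1 + (1 - pmf (\<phi> x) v1) * (v2 * x)) \<le>
          (1 - \<beta>) * (v1 * (1 - x) + v2 * x)"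
        using \<beta> by (intro mult_left_mono) auto
      moreover have "expected_utility (producer_utility v1 v2) \<beta> \<phi> x =
          (1 - \<beta>) * (pmf (\<phi> x) v1 * v1 + (1 - pmf (\<phi> x) v1) * (v2 * x)) +
          \<beta> * (?t * v1 + (1 - ?t) * (v2 * x))"
        using v \<beta> x \<phi> by (simp add: expected_producer_utility_eq low_price_prob_optimal)
      ultimately have "expected_utility (producer_utility v1 v2) \<beta> \<phi> x \<le>
          (1 - \<beta>) * (v1 * (1 - x) + v2 * x) + \<beta> * (?t * v1 + (1 - ?t) * (v2 * x))"
        by linarith
      also have "\<dots> = ?c + ?d * x"
        by (simp add: algebra_simps)
      finally show "expected_utility (producer_utility v1 v2) \<beta> \<phi> x \<le> ?c + ?d * x" .
    qed simp
    also have "\<dots> = max_utility_formula v1 v2 a \<beta>"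
      unfolding segmentation_sum_affine[OF \<sigma>] by (simp add: max_utility_formula_def algebra_simps)
    finally show "(\<Sum>x\<in>set_pmf \<sigma>. pmf \<sigma> x * expected_utility (producer_utility v1 v2) \<beta> \<phi> x)
        \<le> max_utility_formula v1 v2 a \<beta>" .
  qed
qed

text \<open>
  For \<open>\<beta> = 1\<close> the observation is pure noise; the prior mean \<open>1/2\<close> makes both prices optimal
  exactly when \<open>v1 / v2 = 1/2\<close>.
\<close>

lemma is_max_producer_utility_noise:
  assumes v: "0 < v1" "v2 = 2 * v1" and a: "0 \<le> a" "a \<le> 1"
  shows "is_max_producer_utility v1 v2 a 1 (max v1 (v2 * a))"
proof -
  \<comment> \<open>Since both prices are optimal at every observation, the rule may post the one
    that is better on the aggregated market.\<close>
  let ?p = "if v2 * a \<le> v1 then v1 else v2"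
  have v12: "v1 < v2" using v by simp
  have opt: "optimal_pricing_rule v1 v2 1 (\<lambda>_. return_pmf ?p)"
    using v v12 by (intro optimal_pricing_rule_return)
      (auto simp: optimal_price_low_high_iff)
  \<comment> \<open>At \<open>\<beta> = 1\<close> only the noise part remains. It is affine in the
    market, so the segmentation is irrelevant.\<close>
  have eq: "(\<Sum>x\<in>set_pmf \<sigma>. pmf \<sigma> x * expected_utility (producer_utility v1 v2) 1 \<phi> x) =
      low_price_prob v1 \<phi> * v1 + (1 - low_price_prob v1 \<phi>) * (v2 * a)"
    if \<sigma>: "segmentation a \<sigma>" and \<phi>: "optimal_pricing_rule v1 v2 1 \<phi>" for \<sigma> \<phi>
  proof -
    have "(\<Sum>x\<in>set_pmf \<sigma>. pmf \<sigma> x * expected_utility (producer_utility v1 v2) 1 \<phi> x) =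
      (\<Sum>x\<in>set_pmf \<sigma>. pmf \<sigma> x * (low_price_prob v1 \<phi> * v1 + (1 - low_price_prob v1 \<phi>) * v2 * x))"
    proof (rule sum.cong)
      fix x assume "x \<in> set_pmf \<sigma>"
      then have "x \<in> {0..1}" using \<sigma> by (auto simp: segmentation_def)
      then show "pmf \<sigma> x * expected_utility (producer_utility v1 v2) 1 \<phi> x =
          pmf \<sigma> x * (low_price_prob v1 \<phi> * v1 + (1 - low_price_prob v1 \<phi>) * v2 * x)"
        using v(1) v12 \<phi> by (simp add: expected_producer_utility_eq)
    qed simp
    then show ?thesis by (simp add: segmentation_sum_affine[OF \<sigma>])
  qed
  show ?thesis
  proof (rule is_max_producer_utilityI[OF segmentation_full_disclosure[OF a] opt])
    show "(\<Sum>x\<in>set_pmf (full_disclosure a). pmf (full_disclosure a) x *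
        expected_utility (producer_utility v1 v2) 1 (\<lambda>_. return_pmf ?p) x) = max v1 (v2 * a)"
      unfolding eq[OF segmentation_full_disclosure[OF a] opt] using v12
      by (auto simp: low_price_prob_def)
  next
    fix \<sigma> \<phi> assume "segmentation a \<sigma>" "optimal_pricing_rule v1 v2 1 \<phi>"
    then show "(\<Sum>x\<in>set_pmf \<sigma>. pmf \<sigma> x * expected_utility (producer_utility v1 v2) 1 \<phi> x) \<le> max v1 (v2 * a)"
      using low_price_prob_bounds[of v1 \<phi>] by (simp only: eq) (intro convex_bound_le, auto)
  qed
qed

section \<open>Monotonicity\<close>

text \<open>The constant term cancels, and the sign is left to a factor that depends on the two
  parameters only through \<open>(1 - \<beta>1) * (1 - \<beta>2)\<close>.\<close>

lemma max_utility_formula_diff: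
  assumes "0 < v2" "\<beta>1 < 1" "\<beta>2 < 1" "\<eta> = v1 / v2"
  shows "max_utility_formula v1 v2 a \<beta>1 - max_utility_formula v1 v2 a \<beta>2 =
    v2 * (\<beta>2 - \<beta>1) * ((\<eta> * (1 - a) - (\<eta> - a) / 2) * ((1 - \<beta>1) * (1 - \<beta>2)) - (\<eta> - a) * (\<eta> - 1/2))
      / ((1 - \<beta>1) * (1 - \<beta>2))"
proof -
  \<comment> \<open>In terms of \<open>s\<close> the threshold is
    \<open>1/2 + (\<eta> - 1/2) / s\<close>, whence the term in \<open>1 / s\<close>.\<close>
  have form: "max_utility_formula v1 v2 a (1 - s) =
     v2 * (a + (\<eta> - a) * (1 - \<eta>) + (\<eta> * (1 - a) - (\<eta> - a) / 2) * s + (\<eta> - a) * (\<eta> - 1/2) / s)"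
    if "0 < s" for s
  proof -
    have "v1 = \<eta> * v2" using assms by simp
    then show ?thesis
      using that unfolding max_utility_formula_def price_threshold_def assms(4)[symmetric]
      by (simp add: field_simps)
  qed
  have diff: "v2 * (C + A * s1 + B / s1) - v2 * (C + A * s2 + B / s2) =
      v2 * (s1 - s2) * (A * (s1 * s2) - B) / (s1 * s2)"
    if "0 < s1" "0 < s2" for A B C s1 s2 :: real
    using that by (simp add: field_simps)
  show ?thesis
    using form[of "1 - \<beta>1"] form[of "1 - \<beta>2"] diff[of "1 - \<beta>1" "1 - \<beta>2"] assms(2,3) by simp
qed

text \<open>Existence of the maximum gives the definite description its meaning. Sufficiency is
  proved for strict decrease and necessity from weak decrease, which settles both readings.\<close>

theorem lemma2:
  fixes v1 v2 \<eta> \<alpha>star :: real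
  assumes "0 < v1" and "v1 < v2" and "\<eta> = v1 / v2" and "0 \<le> \<alpha>star" and "\<alpha>star \<le> 1"
  shows "(\<forall>\<beta>\<in>{0..min (2 * \<eta>) (2 * (1 - \<eta>))}. \<exists>u. is_max_producer_utility v1 v2 \<alpha>star \<beta> u) \<and>
    (strict_antimono_on ({0..min (2 * \<eta>) (2 * (1 - \<eta>))} - {1}) (max_producer_utility v1 v2 \<alpha>star) \<longleftrightarrow>
       (\<alpha>star \<ge> 1/2 \<and> \<eta> \<ge> 1/2) \<or> (\<alpha>star \<le> 1/2 \<and> \<eta> \<le> 1/2)) \<and>
    (antimono_on ({0..min (2 * \<eta>) (2 * (1 - \<eta>))} - {1}) (max_producer_utility v1 v2 \<alpha>star) \<longleftrightarrow>
       (\<alpha>star \<ge> 1/2 \<and> \<eta> \<ge> 1/2) \<or> (\<alpha>star \<le> 1/2 \<and> \<eta> \<le> 1/2))"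
proof -
  define I where "I = {0..min (2 * \<eta>) (2 * (1 - \<eta>))}"
  let ?F = "max_producer_utility v1 v2 \<alpha>star"
  let ?cond = "(\<alpha>star \<ge> 1/2 \<and> \<eta> \<ge> 1/2) \<or> (\<alpha>star \<le> 1/2 \<and> \<eta> \<le> 1/2)"
  define A where "A = \<eta> * (1 - \<alpha>star) - (\<eta> - \<alpha>star) / 2"
  define B where "B = (\<eta> - \<alpha>star) * (\<eta> - 1/2)"
  have \<eta>: "0 < \<eta>" "\<eta> < 1" using assms by auto
  \<comment> \<open>The bounds \<open>2 * \<eta>\<close> and \<open>2 * (1 - \<eta>)\<close> add up
    to 2, so no point of \<open>I\<close> exceeds 1.\<close>
  have I: "0 \<le> \<beta>" "\<beta> < 1" "\<beta> \<le> 2 * \<eta>" "\<beta> \<le> 2 * (1 - \<eta>)" if "\<beta> \<in> I - {1}" for \<beta>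
    using that by (auto simp: I_def)
  have max: "is_max_producer_utility v1 v2 \<alpha>star \<beta> (max_utility_formula v1 v2 \<alpha>star \<beta>)" if "\<beta> \<in> I - {1}" for \<beta>
    using I[OF that] assms by (intro is_max_producer_utility_formula) auto
  have ex: "\<exists>u. is_max_producer_utility v1 v2 \<alpha>star \<beta> u" if "\<beta> \<in> I" for \<beta>
  proof (cases "\<beta> = 1")
    case True
    then have "\<eta> = 1/2" using that by (auto simp: I_def)
    then have "v2 = 2 * v1" using assms by (simp add: field_simps)
    then show ?thesis
      using is_max_producer_utility_noise assms True by blast
  qed (use that max in blast)
  have diff: "?F \<beta>1 - ?F \<beta>2 = v2 * (\<beta>2 - \<beta>1) * (A * ((1 - \<beta>1) * (1 - \<beta>2)) - B) / ((1 - \<beta>1) * (1 - \<beta>2))"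
    if "\<beta>1 \<in> I - {1}" "\<beta>2 \<in> I - {1}" for \<beta>1 \<beta>2
    using that[THEN max, THEN max_producer_utility_eqI] that[THEN I(2)] assms
    by (simp add: max_utility_formula_diff A_def B_def)
  have AB: "0 < A - B"
  proof -
    have "A - B = \<eta> * (1 - \<eta>)" by (simp add: A_def B_def algebra_simps)
    then show ?thesis using \<eta> by simp
  qed
  \<comment> \<open>At the right end of \<open>I\<close>, \<open>1 - \<beta>\<close> equals
    \<open>\<bar>2 * \<eta> - 1\<bar>\<close>; its square bounds the products
    \<open>(1 - \<beta>1) * (1 - \<beta>2)\<close> from below.\<close>
  have end_pt: "A * (2 * \<eta> - 1)\<^sup>2 - B = \<eta> * (1 - \<eta>) * ((2 * \<eta> - 1) * (2 * \<alpha>star - 1))"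
    by (simp add: A_def B_def power2_eq_square field_simps)
  have cond: "?cond \<longleftrightarrow> 0 \<le> (2 * \<eta> - 1) * (2 * \<alpha>star - 1)"
    by (auto simp: zero_le_mult_iff)
  have strict: "strict_antimono_on (I - {1}) ?F" if ?cond
  proof (rule monotone_onI)
    fix \<beta>1 \<beta>2 assume b: "\<beta>1 \<in> I - {1}" "\<beta>2 \<in> I - {1}" "\<beta>1 < \<beta>2"
    let ?s = "\<bar>2 * \<eta> - 1\<bar>" and ?r = "(1 - \<beta>1) * (1 - \<beta>2)"
    have s: "?s \<le> 1 - \<beta>2" "?s < 1 - \<beta>1" "1 - \<beta>2 \<le> 1" "1 - \<beta>1 \<le> 1" "0 < 1 - \<beta>2" "0 < 1 - \<beta>1"
      using b by (auto simp: I_def min_def split: if_splits)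
    have r: "0 < ?r" "?r \<le> 1"
      using s by (auto intro: mult_le_one)
    have "?s * ?s \<le> ?s * (1 - \<beta>2)" using s by (intro mult_left_mono) auto
    also have "\<dots> < ?r" using s by (intro mult_strict_right_mono) auto
    finally have sr: "(2 * \<eta> - 1)\<^sup>2 < ?r" by (simp add: power2_eq_square abs_mult_self_eq)
    have "0 \<le> A * (2 * \<eta> - 1)\<^sup>2 - B"
      using that \<eta> unfolding end_pt cond by simp
    then have "0 < A * ?r - B"
    \<comment> \<open>An affine function of \<open>?r\<close> is bounded below by its value at one
      end: the left one if \<open>A\<close> is positive, otherwise 1.\<close>
    proof (cases "0 < A")
      case True
      then have "A * (2 * \<eta> - 1)\<^sup>2 < A * ?r" using sr by simp
      then show ?thesis using \<open>0 \<le> A * (2 * \<eta> - 1)\<^sup>2 - B\<close> by linarith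
    next
      case False
      then have "A * 1 \<le> A * ?r" using r(2) by (intro mult_left_mono_neg) auto
      then show ?thesis using AB by linarith
    qed
    then have "0 < ?F \<beta>1 - ?F \<beta>2"
      unfolding diff[OF b(1,2)] using r(1) s b(3) assms by (intro divide_pos_pos mult_pos_pos) auto
    then show "?F \<beta>2 < ?F \<beta>1" by simp
  qed
  have weak: "antimono_on (I - {1}) ?F" if "strict_antimono_on (I - {1}) ?F"
    using that unfolding monotone_on_def by (metis order.order_iff_strict)
  have necessary: ?cond if anti: "antimono_on (I - {1}) ?F"
  proof (rule ccontr)
    assume neg: "\<not> ?cond"
    let ?s = "\<bar>2 * \<eta> - 1\<bar>"
    \<comment> \<open>Failure of the condition excludes \<open>\<eta> = 1/2\<close>, so the right
      end \<open>1 - ?s\<close> of \<open>I\<close> differs from the removed point 1.\<close>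
    have s: "0 < ?s" "?s < 1" using neg \<eta> by auto
    have "A * ?s\<^sup>2 - B < 0"
      using neg \<eta> unfolding power2_abs end_pt cond by (simp add: mult_pos_neg)
    then have lt: "A * ?s\<^sup>2 < B" by simp
    have "0 < A"
    proof (rule ccontr)
      assume "\<not> 0 < A"
      then have "A * 1 \<le> A * ?s\<^sup>2" using s by (intro mult_left_mono_neg) (simp_all add: abs_square_le_1)
      then show False using lt AB by simp
    qed
    then have "?s < B / (A * ?s)" using lt s by (simp add: field_simps power2_eq_square)
    \<comment> \<open>With \<open>r\<close> slightly above \<open>?s\<close>, the product
      \<open>r * ?s\<close> is still so small that the increment from \<open>1 - r\<close> to the
      right end has the wrong sign.\<close>
    then obtain r where r: "?s < r" "r < 1" "r < B / (A * ?s)"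
      using s dense[of ?s "min 1 (B / (A * ?s))"] by auto
    have "A * (r * ?s) < B" using r(3) s \<open>0 < A\<close> by (simp add: field_simps)
    moreover have b: "1 - r \<in> I - {1}" "1 - ?s \<in> I - {1}"
      using r s \<eta> by (auto simp: I_def min_def)
    ultimately have "?F (1 - r) - ?F (1 - ?s) < 0"
      unfolding diff[OF b] using r s assms
      by (intro divide_neg_pos mult_pos_neg mult_pos_pos) auto
    moreover have "?F (1 - ?s) \<le> ?F (1 - r)"
      using monotone_onD[OF anti b] r by simp
    ultimately show False by simp
  qed
  show ?thesis
    using ex strict weak necessary unfolding I_def by blast
qed

end
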